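(* For any tree $T$ with maximum degree $\Delta$, $\Delta+1\leq\chi_{td}(T)\leq 2\Delta+1$.
   Context: Graphs are finite, simple and undirected. A total labeling of a graph $G$ is a function $f:V(G)\cup E(G)\to\mathbb{Z}^+$ (positive integers) such that $f(u)\neq f(v)$ for adjacent vertices $u,v$; $f(\{u,v\})\neq f(\{v,w\})$ for any two distinct incident edges $\{u,v\},\{v,w\}$; and $f(u)\neq f(\{u,v\})$ for every edge $\{u,v\}$ and incident vertex $u$. It is a $k$-total labeling if the maximum label assigned to any vertex or edge is $k$. A $k$-total difference labeling is a $k$-total labeling $f$ with $f(\{u,v\})=|f(u)-f(v)|$ for every edge $\{u,v\}$. The total difference chromatic number $\chi_{td}(G)$ is the smallest integer $k$ for which $G$ has a $k$-total difference labeling. *)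

theory Defs
  imports Main
begin

(* A graph is given by its vertex set V and its set E of edges, each edge being an
   unordered pair {u, v}.  The notions of Graph_Theory are not used: there an undirected
   graph is a symmetric digraph, in which u, v, u already counts as a cycle, so that
   its trees have no edges. *)

definition simple_graph :: "'a set \<Rightarrow> 'a set set \<Rightarrow> bool" where
  "simple_graph V E \<longleftrightarrow> finite V \<and> (\<forall>e\<in>E. e \<subseteq> V \<and> card e = 2)"

definition connected_graph :: "'a set \<Rightarrow> 'a set set \<Rightarrow> bool" where
  "connected_graph V E \<longleftrightarrow>
     V \<noteq> {} \<and> (\<forall>u\<in>V. \<forall>v\<in>V. (u, v) \<in> {(x, y). {x, y} \<in> E}\<^sup>*)"

definition is_cycle :: "'a set set \<Rightarrow> 'a list \<Rightarrow> bool" where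
  "is_cycle E c \<longleftrightarrow> length c \<ge> 3 \<and> distinct c \<and>
     successively (\<lambda>u v. {u, v} \<in> E) c \<and> {last c, hd c} \<in> E"

definition tree :: "'a set \<Rightarrow> 'a set set \<Rightarrow> bool" where
  "tree V E \<longleftrightarrow> simple_graph V E \<and> connected_graph V E \<and> (\<nexists>c. is_cycle E c)"

definition degree :: "'a set set \<Rightarrow> 'a \<Rightarrow> nat" where
  "degree E v = card {e \<in> E. v \<in> e}"

definition max_degree :: "'a set \<Rightarrow> 'a set set \<Rightarrow> nat" where
  "max_degree V E = Max (degree E ` V)"

(* A labeling is one function on the disjoint union of V and E: Inl v is the vertex v and
   Inr e is the edge e.  Its values outside V <+> E are irrelevant. *)

definition total_labeling :: "'a set \<Rightarrow> 'a set set \<Rightarrow> ('a + 'a set \<Rightarrow> nat) \<Rightarrow> bool" where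
  "total_labeling V E f \<longleftrightarrow>
     (\<forall>x \<in> V <+> E. f x > 0) \<and>
     (\<forall>u v. {u, v} \<in> E \<longrightarrow> f (Inl u) \<noteq> f (Inl v)) \<and>
     (\<forall>u v w. {u, v} \<in> E \<and> {v, w} \<in> E \<and> {u, v} \<noteq> {v, w} \<longrightarrow>
        f (Inr {u, v}) \<noteq> f (Inr {v, w})) \<and>
     (\<forall>u v. {u, v} \<in> E \<longrightarrow> f (Inl u) \<noteq> f (Inr {u, v}))"

definition k_total_labeling ::
  "nat \<Rightarrow> 'a set \<Rightarrow> 'a set set \<Rightarrow> ('a + 'a set \<Rightarrow> nat) \<Rightarrow> bool" where
  "k_total_labeling k V E f \<longleftrightarrow> total_labeling V E f \<and> Max (f ` (V <+> E)) = k"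

definition k_total_difference_labeling ::
  "nat \<Rightarrow> 'a set \<Rightarrow> 'a set set \<Rightarrow> ('a + 'a set \<Rightarrow> nat) \<Rightarrow> bool" where
  "k_total_difference_labeling k V E f \<longleftrightarrow> k_total_labeling k V E f \<and>
     (\<forall>u v. {u, v} \<in> E \<longrightarrow>
        int (f (Inr {u, v})) = \<bar>int (f (Inl u)) - int (f (Inl v))\<bar>)"

definition chi_td :: "'a set \<Rightarrow> 'a set set \<Rightarrow> nat" where
  "chi_td V E = (LEAST k. \<exists>f. k_total_difference_labeling k V E f)"

end

(* Lower bound: at a vertex of maximum degree, the edge labels and the vertex label are
   max_degree + 1 distinct positive integers.  Upper bound: label the tree greedily with
   1, ..., 2 * max_degree + 1, vertex by vertex outwards from a root.  A new vertex has exactly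
   one labeled neighbour v, whose label a admits at least max_degree differences d such that
   one of a - d, a + d is a legal neighbouring label, and fewer than max_degree of these
   differences are already used at v. *)

theory Submission
  imports Defs
begin

section \<open>Finite simple graphs\<close>

lemma simple_graph_edgeD:
  assumes "simple_graph V E" "{u, v} \<in> E"
  shows "u \<noteq> v" "u \<in> V" "v \<in> V"
proof -
  have "card {u, v} = 2" "{u, v} \<subseteq> V" using assms unfolding simple_graph_def by blast+
  then show "u \<noteq> v" "u \<in> V" "v \<in> V" by (cases "u = v", auto)
qed

lemma simple_graph_edgeE:
  assumes "simple_graph V E" "e \<in> E" "v \<in> e"
  obtains u where "e = {u, v}" "u \<noteq> v"
proof -
  have "card e = 2" using assms by (auto simp: simple_graph_def)
  then obtain x y where "e = {x, y}" "x \<noteq> y" by (auto simp: card_2_iff)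
  with \<open>v \<in> e\<close> that show thesis by (auto simp: insert_commute)
qed

lemma simple_graph_finite:
  assumes "simple_graph V E"
  shows "finite V" "finite E"
proof -
  show "finite V" using assms by (simp add: simple_graph_def)
  moreover have "E \<subseteq> Pow V" using assms by (auto simp: simple_graph_def)
  ultimately show "finite E" using finite_subset by blast
qed

lemma card_neighbours_le_degree:
  assumes "finite E" "\<And>u. u \<in> N \<Longrightarrow> {u, v} \<in> E"
  shows "card N \<le> degree E v"
proof -
  have "inj_on (\<lambda>u. {u, v}) N" by (auto simp: inj_on_def doubleton_eq_iff)
  moreover have "(\<lambda>u. {u, v}) ` N \<subseteq> {e \<in> E. v \<in> e}" using assms(2) by auto
  ultimately show ?thesis using assms(1) unfolding degree_def by (intro card_inj_on_le) auto
qed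

lemma degree_le_max_degree: "finite V \<Longrightarrow> v \<in> V \<Longrightarrow> degree E v \<le> max_degree V E"
  by (simp add: max_degree_def)

text \<open>Otherwise \<open>S\<close> would be closed under adjacency, and a walk starting in
  \<open>S\<close> could never reach a vertex outside it. This supplies the next vertex to
  label.\<close>

lemma connected_graph_boundary_edge:
  assumes "connected_graph V E" "S \<subseteq> V" "S \<noteq> {}" "S \<noteq> V"
  obtains v w where "v \<in> S" "w \<notin> S" "{v, w} \<in> E"
proof (rule ccontr)
  assume "\<not> thesis"
  then have closed: "w \<in> S" if "v \<in> S" "{v, w} \<in> E" for v w
    using that \<open>\<And>v w. v \<in> S \<Longrightarrow> w \<notin> S \<Longrightarrow> {v, w} \<in> E \<Longrightarrow> thesis\<close> by blast
  obtain r where "r \<in> S" using assms by blast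
  obtain x where "x \<in> V" "x \<notin> S" using assms by blast
  have "(r, x) \<in> {(x, y). {x, y} \<in> E}\<^sup>*"
    using assms \<open>r \<in> S\<close> \<open>x \<in> V\<close> by (auto simp: connected_graph_def)
  then have "x \<in> S" by (induction rule: rtrancl_induct) (use \<open>r \<in> S\<close> closed in auto)
  with \<open>x \<notin> S\<close> show False by blast
qed

section \<open>Paths and acyclicity\<close>

definition path_in :: "'a set set \<Rightarrow> 'a set \<Rightarrow> 'a \<Rightarrow> 'a \<Rightarrow> 'a list \<Rightarrow> bool" where
  "path_in E S u v p \<longleftrightarrow> p \<noteq> [] \<and> distinct p \<and> set p \<subseteq> S \<and> hd p = u \<and> last p = v \<and>
     successively (\<lambda>x y. {x, y} \<in> E) p"

text \<open>This is the invariant of the labeled vertex set: it plays the role of a subtree. Paths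
  stay inside the set, so a vertex outside it can be prepended without repetition.\<close>

definition path_connected_in :: "'a set set \<Rightarrow> 'a set \<Rightarrow> bool" where
  "path_connected_in E S \<longleftrightarrow> (\<forall>u\<in>S. \<forall>v\<in>S. \<exists>p. path_in E S u v p)"

lemma path_in_mono: "path_in E S u v p \<Longrightarrow> S \<subseteq> T \<Longrightarrow> path_in E T u v p"
  by (auto simp: path_in_def)

lemma path_in_rev: "path_in E S u v p \<Longrightarrow> path_in E S v u (rev p)"
  by (auto simp: path_in_def hd_rev last_rev insert_commute)

lemma path_in_Cons:
  assumes "path_in E S v u p" "w \<notin> S" "{v, w} \<in> E"
  shows "path_in E (insert w S) w u (w # p)"
  using assms by (auto simp: path_in_def successively_Cons insert_commute)

lemma path_connected_in_singleton: "path_connected_in E {r}"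
proof -
  have "path_in E {r} r r [r]" by (simp add: path_in_def)
  then show ?thesis unfolding path_connected_in_def by blast
qed

lemma path_connected_in_insert:
  assumes "path_connected_in E S" "v \<in> S" "w \<notin> S" "{v, w} \<in> E"
  shows "path_connected_in E (insert w S)"
proof -
  have from_w: "\<exists>p. path_in E (insert w S) w u p" if "u \<in> insert w S" for u
  proof (cases "u = w")
    case True
    then have "path_in E (insert w S) w u [w]" by (simp add: path_in_def)
    then show ?thesis by blast
  next
    case False
    then show ?thesis
      using that assms path_in_Cons[OF _ assms(3,4)] unfolding path_connected_in_def by blast
  qed
  have "\<exists>p. path_in E (insert w S) x y p" if xy: "x \<in> insert w S" "y \<in> insert w S" for x y
  proof (cases "x = w \<or> y = w")
    case True
    then show ?thesis using from_w xy path_in_rev by metis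
  next
    case False
    then have "x \<in> S" "y \<in> S" using xy by auto
    then obtain p where "path_in E S x y p"
      using assms(1) unfolding path_connected_in_def by blast
    then have "path_in E (insert w S) x y p" by (rule path_in_mono) auto
    then show ?thesis by blast
  qed
  then show ?thesis unfolding path_connected_in_def by blast
qed

text \<open>Two neighbours of \<open>w\<close> in \<open>S\<close> are joined by a path that avoids
  \<open>w\<close>, and adding \<open>w\<close> would close that path into a cycle. This is where
  acyclicity enters.\<close>

lemma acyclic_unique_neighbour:
  assumes "\<nexists>c. is_cycle E c" "path_connected_in E S" "w \<notin> S"
    and "u \<in> S" "v \<in> S" "{u, w} \<in> E" "{v, w} \<in> E"
  shows "u = v"
proof (rule ccontr)
  assume "u \<noteq> v"
  obtain p where p: "path_in E S u v p" using assms unfolding path_connected_in_def by blast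
  \<comment> \<open>Distinct ends force two vertices on \<open>p\<close>, so \<open>w # p\<close>
    reaches the three that \<open>is_cycle\<close> demands.\<close>
  have "length p \<ge> 2"
    using p \<open>u \<noteq> v\<close> by (cases p rule: remdups_adj.cases) (auto simp: path_in_def)
  moreover have "path_in E (insert w S) w v (w # p)" using path_in_Cons[OF p] assms by blast
  ultimately have "is_cycle E (w # p)"
    using assms(7) by (auto simp: path_in_def is_cycle_def)
  with assms(1) show False by blast
qed

section \<open>Difference labelings of vertices\<close>

text \<open>The last two conditions say that neither (positive) label equals the difference of the two.\<close>

definition compatible :: "nat \<Rightarrow> nat \<Rightarrow> bool" where
  "compatible a b \<longleftrightarrow> a \<noteq> b \<and> b \<noteq> 2 * a \<and> a \<noteq> 2 * b"

lemma compatible_commute: "compatible a b \<longleftrightarrow> compatible b a"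
  by (auto simp: compatible_def)

definition label_diff :: "nat \<Rightarrow> nat \<Rightarrow> nat" where
  "label_diff a b = nat \<bar>int a - int b\<bar>"

lemma label_diff_commute: "label_diff a b = label_diff b a"
  by (simp add: label_diff_def abs_minus_commute)

text \<open>From the lower half of the range one moves up from \<open>a\<close>, otherwise down. On
  the chosen side at most one difference is illegal, and at least D legal ones remain, too many for
  \<open>X\<close> to contain them all.\<close>

lemma exists_compatible_label:
  assumes a: "1 \<le> a" "a \<le> 2 * D + 1" and X: "finite X" "card X < D"
  shows "\<exists>b. 1 \<le> b \<and> b \<le> 2 * D + 1 \<and> compatible a b \<and> label_diff a b \<notin> X"
proof (cases "a \<le> D + 1")
  case True
  \<comment> \<open>Going up, only \<open>d = a\<close> is illegal, since it gives
    \<open>b = 2 * a\<close>. For \<open>a = D + 1\<close> the range has just D elements, but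
    \<open>a\<close> lies outside it.\<close>
  have "D \<le> card ({1..2 * D + 1 - a} - {a})"
    using True a by (cases "a = D + 1") (auto simp: card_Diff_singleton_if)
  then have "\<not> {1..2 * D + 1 - a} - {a} \<subseteq> X"
    using X card_mono[of X "{1..2 * D + 1 - a} - {a}"] by linarith
  then obtain d where "d \<in> {1..2 * D + 1 - a}" "d \<noteq> a" "d \<notin> X" by blast
  then show ?thesis using a by (intro exI[of _ "a + d"]) (auto simp: compatible_def label_diff_def)
next
  case False
  \<comment> \<open>Going down to \<open>b = a - d\<close>, the forbidden \<open>a = 2 * b\<close>
    means \<open>a = 2 * d\<close>. The range has at least D + 1 elements and loses at most this
    one.\<close>
  let ?Y = "{1..a - 1} - {d. a = 2 * d}"
  have "D \<le> card ?Y"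
  proof (cases "even a")
    case True
    then obtain h where "a = 2 * h" by blast
    then have "{d. a = 2 * d} = {h}" by auto
    then show ?thesis using False by (auto simp: card_Diff_singleton_if)
  next
    case odd: False
    then have "?Y = {1..a - 1}" by auto
    then show ?thesis using False by (simp only: card_atLeastAtMost)
  qed
  then have "\<not> ?Y \<subseteq> X"
    using X card_mono[of X ?Y] by linarith
  then obtain d where "d \<in> {1..a - 1}" "a \<noteq> 2 * d" "d \<notin> X" by blast
  then show ?thesis using a by (intro exI[of _ "a - d"]) (auto simp: compatible_def label_diff_def)
qed

text \<open>Edge labels are determined by vertex labels, so a vertex function suffices. All
  conditions are restricted to \<open>S\<close> to allow partial labelings.\<close>

definition difference_labeling_on :: "nat \<Rightarrow> 'a set set \<Rightarrow> 'a set \<Rightarrow> ('a \<Rightarrow> nat) \<Rightarrow> bool" where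
  "difference_labeling_on m E S g \<longleftrightarrow>
     (\<forall>v\<in>S. 1 \<le> g v \<and> g v \<le> m) \<and>
     (\<forall>u\<in>S. \<forall>v\<in>S. {u, v} \<in> E \<longrightarrow> compatible (g u) (g v)) \<and>
     (\<forall>u\<in>S. \<forall>v\<in>S. \<forall>w\<in>S. {u, v} \<in> E \<and> {v, w} \<in> E \<and> u \<noteq> w \<longrightarrow>
        label_diff (g u) (g v) \<noteq> label_diff (g v) (g w))"

lemma difference_labeling_on_insert:
  assumes "tree V E" and D: "D = max_degree V E"
    and g: "difference_labeling_on (2 * D + 1) E S g"
    and S: "S \<subseteq> V" "path_connected_in E S"
    and v: "v \<in> S" and w: "w \<notin> S" and vw: "{v, w} \<in> E"
  shows "\<exists>g'. difference_labeling_on (2 * D + 1) E (insert w S) g'"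
proof -
  have simple: "simple_graph V E" and acyclic: "\<nexists>c. is_cycle E c"
    using \<open>tree V E\<close> by (auto simp: tree_def)
  note fin = simple_graph_finite[OF simple]
  define N where "N = {u \<in> S. {u, v} \<in> E}"
  have "finite N" using S fin by (auto simp: N_def intro: rev_finite_subset)
  \<comment> \<open>Counting \<open>w\<close> together with the labeled neighbours of
    \<open>v\<close> makes the bound on \<open>card N\<close> strict: the edge to \<open>w\<close>
    is one of the at most D edges at \<open>v\<close>.\<close>
  have "card (insert w N) \<le> degree E v"
    using vw by (intro card_neighbours_le_degree fin) (auto simp: N_def insert_commute)
  also have "\<dots> \<le> D" using degree_le_max_degree[OF fin(1), of v E] S(1) v D by auto
  finally have "card N < D" using \<open>finite N\<close> w by (simp add: N_def)
  then have "card ((\<lambda>u. label_diff (g v) (g u)) ` N) < D"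
    using card_image_le[OF \<open>finite N\<close>] le_less_trans by blast
  moreover have "1 \<le> g v" "g v \<le> 2 * D + 1" using g v by (auto simp: difference_labeling_on_def)
  ultimately obtain b where b: "1 \<le> b" "b \<le> 2 * D + 1" "compatible (g v) b"
      "label_diff (g v) b \<notin> (\<lambda>u. label_diff (g v) (g u)) ` N"
    using exists_compatible_label \<open>finite N\<close> by blast
  have nb: "u = v" if "u \<in> S" "{u, w} \<in> E" for u
    using acyclic_unique_neighbour[OF acyclic S(2) w] that v vw by blast
  have nb': "u = v" if "u \<in> S" "{w, u} \<in> E" for u
    using nb that by (simp add: insert_commute)
  have "{w} \<notin> E" using simple by (auto simp: simple_graph_def)
  \<comment> \<open>The only new edge is the one joining \<open>v\<close> and \<open>w\<close>, so
    every new constraint involves it.\<close>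
  have edge_cases: "x = w \<and> y = v \<or> x = v \<and> y = w \<or> x \<in> S \<and> y \<in> S"
    if xy: "x \<in> insert w S" "y \<in> insert w S" "{x, y} \<in> E" for x y
    using xy nb[of x] nb'[of y] \<open>{w} \<notin> E\<close> by auto
  have new: "label_diff (g v) b \<noteq> label_diff (g v) (g u)" if "u \<in> S" "{u, v} \<in> E" for u
    using b(4) that by (auto simp: N_def)
  have new': "label_diff (g u) (g v) \<noteq> label_diff (g v) b" if "u \<in> S" "{u, v} \<in> E" for u
    using new[OF that] by (simp add: label_diff_commute)
  have new'': "label_diff b (g v) \<noteq> label_diff (g v) (g u)" if "u \<in> S" "{v, u} \<in> E" for u
    using new that by (simp add: label_diff_commute insert_commute)
  let ?g = "g(w := b)"
  have old: "?g u = g u" if "u \<in> S" for u using that w by auto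
  have "1 \<le> ?g x \<and> ?g x \<le> 2 * D + 1" if "x \<in> insert w S" for x
    using g b that by (auto simp: difference_labeling_on_def)
  moreover have "compatible (?g x) (?g y)" if xy: "x \<in> insert w S" "y \<in> insert w S" "{x, y} \<in> E" for x y
  proof -
    consider "x = w" "y = v" | "x = v" "y = w" | "x \<in> S" "y \<in> S"
      using edge_cases[OF xy] by blast
    then show ?thesis
    proof cases
      case 1
      then show ?thesis using b(3) v w compatible_commute by auto
    next
      case 2
      then show ?thesis using b(3) v w by auto
    next
      case 3
      then show ?thesis using g xy(3) old by (simp add: difference_labeling_on_def)
    qed
  qed
  moreover have "label_diff (?g x) (?g y) \<noteq> label_diff (?g y) (?g z)"
    if xyz: "x \<in> insert w S" "y \<in> insert w S" "z \<in> insert w S" "{x, y} \<in> E" "{y, z} \<in> E" "x \<noteq> z" for x y z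
  proof -
    \<comment> \<open>The middle vertex cannot be \<open>w\<close>, since then both ends would be
      \<open>v\<close>.\<close>
    consider "x = w" "y = v" "z \<in> S" | "x \<in> S" "y = v" "z = w" | "x \<in> S" "y \<in> S" "z \<in> S"
      using edge_cases[OF xyz(1,2,4)] edge_cases[OF xyz(2,3,5)] xyz(6) v w by blast
    then show ?thesis
    proof cases
      case 1
      then show ?thesis using new''[of z] xyz(5) v w by auto
    next
      case 2
      then show ?thesis using new'[of x] xyz(4) v w by auto
    next
      case 3
      then show ?thesis using g xyz(4-6) old by (simp add: difference_labeling_on_def)
    qed
  qed
  ultimately have "difference_labeling_on (2 * D + 1) E (insert w S) ?g"
    unfolding difference_labeling_on_def by blast
  then show ?thesis by blast
qed

lemma tree_difference_labeling:
  assumes "tree V E"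
  shows "\<exists>g. difference_labeling_on (2 * max_degree V E + 1) E V g"
proof -
  let ?m = "2 * max_degree V E + 1"
  have simple: "simple_graph V E" and conn: "connected_graph V E"
    using assms by (auto simp: tree_def)
  note fin = simple_graph_finite[OF simple]
  \<comment> \<open>The labeled set grows by one vertex at a time from a single root. Size
    \<open>Suc n\<close> keeps it nonempty, as the search for a boundary edge requires.\<close>
  have "\<exists>S g. S \<subseteq> V \<and> card S = Suc n \<and> path_connected_in E S \<and> difference_labeling_on ?m E S g"
    if "n < card V" for n
    using that
  proof (induction n)
    case 0
    then obtain r where "r \<in> V" by fastforce
    have "{r} \<notin> E" using simple by (auto simp: simple_graph_def)
    then have "difference_labeling_on ?m E {r} (\<lambda>_. 1)"
      by (auto simp: difference_labeling_on_def)
    then show ?case using \<open>r \<in> V\<close> path_connected_in_singleton[of E r]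
      by (intro exI[of _ "{r}"] exI[of _ "\<lambda>_. 1"]) auto
  next
    case (Suc n)
    then obtain S g where S: "S \<subseteq> V" "card S = Suc n" "path_connected_in E S"
      and g: "difference_labeling_on ?m E S g" by auto
    have "S \<noteq> {}" "S \<noteq> V" using S(2) Suc.prems by auto
    then obtain v w where vw: "v \<in> S" "w \<notin> S" "{v, w} \<in> E"
      using connected_graph_boundary_edge[OF conn S(1)] by blast
    obtain g' where "difference_labeling_on ?m E (insert w S) g'"
      using difference_labeling_on_insert[OF assms refl g S(1,3) vw] by blast
    moreover have "path_connected_in E (insert w S)"
      using path_connected_in_insert[OF S(3) vw] .
    moreover have "insert w S \<subseteq> V" using S(1) simple_graph_edgeD[OF simple vw(3)] by blast
    moreover have "card (insert w S) = Suc (Suc n)"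
      using S(1,2) vw(2) fin by (simp add: finite_subset)
    ultimately show ?case by blast
  qed
  \<comment> \<open>The choice \<open>n = card V - 1\<close> yields a labeled set of full size,
    which must be \<open>V\<close>.\<close>
  moreover have "0 < card V" using conn fin by (auto simp: connected_graph_def card_gt_0_iff)
  ultimately obtain S g where "S \<subseteq> V" "card S = card V" "difference_labeling_on ?m E S g"
    by (metis Suc_pred' diff_less zero_less_one)
  then show ?thesis using card_subset_eq fin by blast
qed

section \<open>Bounds for the total difference chromatic number\<close>

lemma k_total_difference_labeling_of_vertices:
  assumes simple: "simple_graph V E" and "V \<noteq> {}" and g: "difference_labeling_on m E V g"
  shows "\<exists>k f. k \<le> m \<and> k_total_difference_labeling k V E f"
proof -
  \<comment> \<open>An edge is an unordered set, so its label must not depend on an order of the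
    ends: maximum minus minimum is the absolute difference.\<close>
  define f where "f = case_sum g (\<lambda>e. Max (g ` e) - Min (g ` e))"
  have fl: "f (Inl v) = g v" for v by (simp add: f_def)
  have fr: "f (Inr {u, v}) = label_diff (g u) (g v)" for u v
    by (auto simp: f_def label_diff_def max_def min_def)
  have edge: "u \<in> V" "v \<in> V" "compatible (g u) (g v)" if "{u, v} \<in> E" for u v
    using simple_graph_edgeD[OF simple that] g that by (auto simp: difference_labeling_on_def)
  have rng: "1 \<le> g v" "g v \<le> m" if "v \<in> V" for v
    using g that by (auto simp: difference_labeling_on_def)
  have bounds: "0 < f x \<and> f x \<le> m" if "x \<in> V <+> E" for x
  proof (cases x)
    case (Inl v)
    then show ?thesis using that rng[of v] by (auto simp: fl)
  next
    case (Inr e)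
    then have "e \<in> E" using that by auto
    then have "card e = 2" using simple by (auto simp: simple_graph_def)
    then obtain u v where e: "e = {u, v}" by (auto simp: card_2_iff)
    with edge[of u v] rng[of u] rng[of v] \<open>e \<in> E\<close> show ?thesis
      by (auto simp: Inr fr label_diff_def compatible_def)
  qed
  have "f (Inr {u, v}) \<noteq> f (Inr {v, w})" if "{u, v} \<in> E" "{v, w} \<in> E" "{u, v} \<noteq> {v, w}" for u v w
  proof -
    have "u \<noteq> w" using that(3) by (auto simp: insert_commute)
    then show ?thesis
      using g that(1,2) edge[OF that(1)] edge[OF that(2)]
      unfolding fr difference_labeling_on_def by blast
  qed
  \<comment> \<open>If \<open>g u\<close> equals the difference, then \<open>g v\<close> is 0 or
    \<open>2 * g u\<close>; positivity and \<open>compatible\<close> exclude both.\<close>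
  moreover have "f (Inl u) \<noteq> f (Inl v)" "f (Inl u) \<noteq> f (Inr {u, v})" if "{u, v} \<in> E" for u v
    using edge[OF that] rng[of u] rng[of v] by (auto simp: fl fr label_diff_def compatible_def)
  ultimately have "total_labeling V E f" using bounds unfolding total_labeling_def by blast
  moreover have "int (f (Inr {u, v})) = \<bar>int (f (Inl u)) - int (f (Inl v))\<bar>" for u v
    by (simp add: fl fr label_diff_def)
  \<comment> \<open>The greedy labeling may miss the value \<open>m\<close>, so k is the largest
    label really used.\<close>
  ultimately have "k_total_difference_labeling (Max (f ` (V <+> E))) V E f"
    by (simp add: k_total_difference_labeling_def k_total_labeling_def)
  moreover have "Max (f ` (V <+> E)) \<le> m"
    using simple_graph_finite[OF simple] \<open>V \<noteq> {}\<close> bounds by (subst Max_le_iff) auto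
  ultimately show ?thesis by blast
qed

lemma k_total_labeling_max_degree_less:
  assumes simple: "simple_graph V E" and "V \<noteq> {}" and f: "k_total_labeling k V E f"
  shows "max_degree V E < k"
proof -
  note fin = simple_graph_finite[OF simple]
  have tot: "total_labeling V E f" and k: "Max (f ` (V <+> E)) = k"
    using f by (auto simp: k_total_labeling_def)
  have rng: "f x \<in> {1..k}" if "x \<in> V <+> E" for x
    using tot fin that Max_ge[of "f ` (V <+> E)" "f x"]
    by (auto simp: total_labeling_def k Suc_le_eq)
  have "Max (degree E ` V) \<in> degree E ` V" using fin \<open>V \<noteq> {}\<close> by (intro Max_in) auto
  then obtain v where v: "v \<in> V" "degree E v = max_degree V E" by (auto simp: max_degree_def)
  let ?A = "{e \<in> E. v \<in> e}"
  let ?B = "(\<lambda>e. f (Inr e)) ` ?A"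
  have "inj_on (\<lambda>e. f (Inr e)) ?A"
  proof (rule inj_onI, rule ccontr)
    fix e e' assume e: "e \<in> ?A" "e' \<in> ?A" "f (Inr e) = f (Inr e')" "e \<noteq> e'"
    obtain u where u: "e = {u, v}" using e simple_graph_edgeE[OF simple, of e v] by auto
    obtain w where "e' = {w, v}" using e simple_graph_edgeE[OF simple, of e' v] by auto
    \<comment> \<open>Writing the shared vertex second in \<open>e\<close> and first in
      \<open>e'\<close> matches the pattern of incident edges in
      \<open>total_labeling\<close>.\<close>
    then have "e' = {v, w}" by auto
    with u e tot show False unfolding total_labeling_def by blast
  qed
  then have "card ?B = max_degree V E" using v by (simp add: card_image degree_def)
  moreover have "f (Inl v) \<notin> ?B"
  proof
    assume "f (Inl v) \<in> ?B"
    then obtain e where e: "e \<in> E" "v \<in> e" "f (Inl v) = f (Inr e)" by auto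
    then obtain u where "e = {v, u}" using simple_graph_edgeE[OF simple] by (metis insert_commute)
    with e tot show False unfolding total_labeling_def by blast
  qed
  moreover have "finite ?B" using fin by simp
  ultimately have "Suc (max_degree V E) = card (insert (f (Inl v)) ?B)" by simp
  also have "\<dots> \<le> card {1..k}" using rng v(1) by (intro card_mono insert_subset[THEN iffD2] conjI image_subsetI) auto
  finally show ?thesis by simp
qed

theorem corollary6p13:
  fixes V :: "'a set" and E :: "'a set set"
  assumes "tree V E"
  shows "max_degree V E + 1 \<le> chi_td V E \<and> chi_td V E \<le> 2 * max_degree V E + 1"
proof -
  have simple: "simple_graph V E" and "V \<noteq> {}"
    using assms by (auto simp: tree_def connected_graph_def)
  obtain g where "difference_labeling_on (2 * max_degree V E + 1) E V g"
    using tree_difference_labeling[OF assms] by blast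
  then obtain k where k: "k \<le> 2 * max_degree V E + 1" "\<exists>f. k_total_difference_labeling k V E f"
    using k_total_difference_labeling_of_vertices[OF simple \<open>V \<noteq> {}\<close>] by blast
  have "chi_td V E \<le> k" unfolding chi_td_def using k(2) by (rule Least_le)
  \<comment> \<open>The labeling built for the upper bound also shows that the least k is attained,
    so the lower bound applies to \<open>chi_td V E\<close> itself.\<close>
  moreover have "\<exists>f. k_total_difference_labeling (chi_td V E) V E f"
    unfolding chi_td_def using k(2) by (rule LeastI)
  then have "max_degree V E < chi_td V E"
    using k_total_labeling_max_degree_less[OF simple \<open>V \<noteq> {}\<close>]
    by (auto simp: k_total_difference_labeling_def)
  ultimately show ?thesis using k(1) by simp
qed

end
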